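(* Let $f:\mathbb{R}^n\to\mathbb{R}\cup\{+\infty\}$ and $g:\mathbb{R}^m\to\mathbb{R}\cup\{+\infty\}$ be proper, lower semicontinuous and convex, and let $M\in\mathbb{R}^{m\times n}$ satisfy $\|M\|\le L_M$ with $L_M>0$. Let $\tau,\sigma>0$ satisfy $\tau\sigma\le\frac{1}{L_M^2}$. Let $x_0\in\mathbb{R}^n$, $u_0\in\mathbb{R}^m$, and let $(x_i,u_i)_{i\ge 1}$ be generated by the Chambolle-Pock iteration $$\begin{cases} x_{i+1}=\mathrm{prox}_{\tau f}\left(x_i-\tau M^Tu_i\right),\\ u_{i+1}=\mathrm{prox}_{\sigma g^*}\left(u_i+\sigma M(2x_{i+1}-x_i)\right).\end{cases}$$ Then for every $N\ge 1$ and for any $x\in\mathbb{R}^n$ and $u\in\mathbb{R}^m$, $$\mathcal{L}(\bar x_N,u)-\mathcal{L}(x,\bar u_N)\le\frac{1}{2(N+1)}\left(\frac{\|x-x_0\|^2}{\tau}+\frac{\|u-u_0\|^2}{\sigma}-2(u-u_0)^TM(x-x_0)\right).$$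
   Context: $\|\cdot\|$ is the Euclidean norm for vectors and the spectral norm (largest singular value) for matrices. $g^*$ is the convex conjugate of $g$. For a proper lower semicontinuous convex function $\phi$, $\mathrm{prox}_{\phi}(z)=\arg\min_y\{\phi(y)+\frac12\|y-z\|^2\}$. The Lagrangian is $\mathcal{L}(x,u)=u^TMx+f(x)-g^*(u)$. The averages are $\bar x_N=\frac1N\sum_{i=1}^N x_i$ and $\bar u_N=\frac1N\sum_{i=1}^N u_i$. If $u\notin\mathrm{dom}\,g^*$ or $x\notin\mathrm{dom}\,f$, the left-hand side is understood to be $-\infty$, so the inequality has content only for $x\in\mathrm{dom}\,f$ and $u\in\mathrm{dom}\,g^*$. *)

theory Defs
  imports "HOL-Analysis.Analysis"
begin

text \<open>
  A function to the reals extended by plus infinity is a function to \<^typ>\<open>ereal\<close>; the exclusion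
  of the value \<open>-\<infinity>\<close> is part of properness.
\<close>

definition proper :: "('a \<Rightarrow> ereal) \<Rightarrow> bool" where
  "proper f \<longleftrightarrow> (\<forall>x. f x \<noteq> -\<infinity>) \<and> (\<exists>x. f x \<noteq> \<infinity>)"

definition lower_semicontinuous :: "('a::topological_space \<Rightarrow> ereal) \<Rightarrow> bool" where
  "lower_semicontinuous f \<longleftrightarrow> (\<forall>x. f x \<le> Liminf (at x) f)"

text \<open>
  Intended for functions without the value \<open>-\<infinity>\<close>, so that no sum \<open>\<infinity> - \<infinity>\<close> occurs on
  the right-hand side; the endpoints \<open>t = 0\<close> and \<open>t = 1\<close> are harmless since \<open>0 * \<infinity> = 0\<close>
  in \<^typ>\<open>ereal\<close>.
\<close>

definition convex_ereal :: "('a::real_vector \<Rightarrow> ereal) \<Rightarrow> bool" where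
  "convex_ereal f \<longleftrightarrow>
    (\<forall>x y. \<forall>t\<in>{0..1}. f ((1 - t) *\<^sub>R x + t *\<^sub>R y) \<le> ereal (1 - t) * f x + ereal t * f y)"

definition conjugate :: "('a::real_inner \<Rightarrow> ereal) \<Rightarrow> 'a \<Rightarrow> ereal" where
  "conjugate g u = (SUP x. ereal (u \<bullet> x) - g x)"

text \<open>
  For proper, lower semicontinuous and convex \<open>\<phi>\<close> on a Euclidean space the minimiser exists and
  is unique, so the choice made by \<^const>\<open>arg_min\<close> is immaterial.
\<close>

definition prox :: "('a::real_inner \<Rightarrow> ereal) \<Rightarrow> 'a \<Rightarrow> 'a" where
  "prox \<phi> z = (ARG_MIN (\<lambda>y. \<phi> y + ereal (1 / 2 * (norm (y - z))\<^sup>2)) y. True)"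

text \<open>
  In \<^typ>\<open>ereal\<close> one has \<open>\<infinity> - \<infinity> = \<infinity>\<close>, so the value is only meaningful if
  \<open>f x\<close> and \<open>conjugate g u\<close> are not both \<open>\<infinity>\<close>. A difference
  \<open>lagrangian M f g x' u - lagrangian M f g x u'\<close> with \<open>f x'\<close> and \<open>conjugate g u'\<close> finite
  evaluates to \<open>-\<infinity>\<close> as soon as \<open>f x\<close> or \<open>conjugate g u\<close> is \<open>\<infinity>\<close>.
\<close>

definition lagrangian ::
  "real^'n^'m \<Rightarrow> (real^'n \<Rightarrow> ereal) \<Rightarrow> (real^'m \<Rightarrow> ereal) \<Rightarrow> real^'n \<Rightarrow> real^'m \<Rightarrow> ereal" where
  "lagrangian M f g x u = ereal (u \<bullet> (M *v x)) + f x - conjugate g u"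

definition average :: "(nat \<Rightarrow> 'a::real_vector) \<Rightarrow> nat \<Rightarrow> 'a" where
  "average x N = (1 / real N) *\<^sub>R (\<Sum>i=1..N. x i)"

end

theory Submission
  imports Defs
begin

text \<open>
  The iteration is a proximal point method for the monotone operator of the saddle problem in the
  semi-inner product given by the block matrix with diagonal \<open>1/\<tau>\<close>, \<open>1/\<sigma>\<close> and off-diagonal
  \<open>-M\<^sup>T\<close>, \<open>-M\<close>, which is positive semidefinite because \<open>\<tau> \<sigma> \<parallel>M\<parallel>\<^sup>2 \<le> 1\<close>. The optimality conditions
  of the two proximal steps bound the gap at \<open>z (i + 1)\<close> against \<open>w = (x, u)\<close> by the product
  of \<open>z i - z (i + 1)\<close> and \<open>z (i + 1) - w\<close>. Summing telescopes to \<open>\<parallel>z 0 - w\<parallel>\<^sup>2 / 2\<close> minus half the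
  squared lengths of the steps and of \<open>z N - w\<close>; keeping the latter improves the classical
  constant \<open>1 / (2 N)\<close> to \<open>1 / (2 (N + 1))\<close>. Jensen's inequality passes to the averages.
\<close>

section \<open>Lower semicontinuous and convex functions\<close>

text \<open>Openness of strict superlevel sets is the working form of semicontinuity: compactness,
  sums and suprema then become statements about covers and unions.\<close>

lemma lower_semicontinuous_iff_open:
  "lower_semicontinuous f \<longleftrightarrow> (\<forall>c. open {x. c < f x})"
proof
  assume lsc: "lower_semicontinuous f"
  show "\<forall>c. open {x. c < f x}"
  proof
    fix c
    have "\<forall>\<^sub>F y in nhds x. c < f y" if "c < f x" for x
    proof -
      have "c < Liminf (at x) f"
        using that lsc less_le_trans unfolding lower_semicontinuous_def by blast
      then have "\<forall>\<^sub>F y in at x. c < f y" by (rule less_LiminfD)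
      then show ?thesis using that by (simp add: eventually_nhds_conv_at)
    qed
    then show "open {x. c < f x}"
      unfolding eventually_nhds by (subst open_subopen) (auto simp: subset_eq)
  qed
next
  assume op: "\<forall>c. open {x. c < f x}"
  have "\<forall>\<^sub>F y in at x. c < f y" if "c < f x" for x c
    using eventually_nhds_in_open[of "{x. c < f x}" x] op that
    by (auto intro: eventually_at_topological[THEN iffD2])
  then show "lower_semicontinuous f"
    unfolding lower_semicontinuous_def le_Liminf_iff by blast
qed

text \<open>If no point of K were minimal, the open sets \<open>{y. h q < h y}\<close> would cover
  K. Among the finitely many centres of a subcover, one with least value would still lie in the set
  of a centre with smaller value.\<close>

lemma lower_semicontinuous_attains_inf:
  assumes lsc: "lower_semicontinuous h" and K: "compact K" "K \<noteq> {}"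
  shows "\<exists>p\<in>K. \<forall>y\<in>K. h p \<le> h y"
proof (rule ccontr)
  assume "\<not> (\<exists>p\<in>K. \<forall>y\<in>K. h p \<le> h y)"
  then have "K \<subseteq> (\<Union>q\<in>K. {y. h q < h y})"
    by (auto simp: not_le)
  then obtain C where C: "C \<subseteq> K" "finite C" "K \<subseteq> (\<Union>q\<in>C. {y. h q < h y})"
    using compactE_image[OF K(1), of K "\<lambda>q. {y. h q < h y}"] lsc
    unfolding lower_semicontinuous_iff_open by metis
  then have "C \<noteq> {}" using K(2) by auto
  then obtain q where "q \<in> C" "\<And>r. r \<in> C \<Longrightarrow> h q \<le> h r"
    using C(2) ex_min_if_finite[of "h ` C"] by (auto simp: not_less)
  moreover obtain r where "r \<in> C" "h r < h q"
    using C(1,3) \<open>q \<in> C\<close> by auto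
  ultimately show False by (simp add: leD)
qed

lemma lower_semicontinuous_add_continuous:
  fixes q :: "'a::topological_space \<Rightarrow> real"
  assumes lsc: "lower_semicontinuous \<phi>" and q: "continuous_on UNIV q"
  shows "lower_semicontinuous (\<lambda>y. \<phi> y + ereal (q y))"
  unfolding lower_semicontinuous_iff_open
proof
  fix c
  have op: "open {y. b < \<phi> y}" for b
    using lsc unfolding lower_semicontinuous_iff_open by blast
  show "open {y. c < \<phi> y + ereal (q y)}"
  proof (cases c)
    case (real b)
    \<comment> \<open>An intermediate real r separates the two summands, so the superlevel set
      becomes a union of intersections of open sets.\<close>
    have "c < \<phi> y + ereal (q y) \<longleftrightarrow> (\<exists>r. ereal r < \<phi> y \<and> b - r < q y)" for y
    proof (cases "\<phi> y")
      case (real s)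
      have "b < s + q y \<longleftrightarrow> (\<exists>r. r < s \<and> b - r < q y)"
      proof
        assume "b < s + q y"
        then have "b - q y < s" by simp
        then obtain r where "b - q y < r" "r < s" using dense by blast
        then show "\<exists>r. r < s \<and> b - r < q y" by (intro exI[of _ r]) simp
      qed auto
      then show ?thesis using real \<open>c = ereal b\<close> by simp
    next
      case PInf
      have "b - (b - q y + 1) < q y" by simp
      then show ?thesis using PInf \<open>c = ereal b\<close> by (auto intro: exI[of _ "b - q y + 1"])
    qed (use real in auto)
    then have "{y. c < \<phi> y + ereal (q y)} = (\<Union>r. {y. ereal r < \<phi> y} \<inter> {y. b - r < q y})"
      by auto
    also have "open \<dots>"
      by (intro open_UN ballI open_Int op open_Collect_less q continuous_intros)
    finally show ?thesis .
  next
    case MInf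
    then have "{y. c < \<phi> y + ereal (q y)} = {y. -\<infinity> < \<phi> y}"
      by auto
    then show ?thesis using op[of "-\<infinity>"] by (simp only:)
  qed simp
qed

lemma lower_semicontinuous_cmult:
  fixes \<phi> :: "'a::perfect_space \<Rightarrow> ereal"
  assumes "lower_semicontinuous \<phi>" "c \<ge> 0"
  shows "lower_semicontinuous (\<lambda>y. ereal c * \<phi> y)"
  using assms unfolding lower_semicontinuous_def
  by (simp add: Liminf_ereal_mult_left ereal_mult_left_mono)

lemma proper_cmult:
  assumes "proper \<phi>" "c > 0"
  shows "proper (\<lambda>y. ereal c * \<phi> y)"
  using assms unfolding proper_def by (auto simp: ereal_mult_eq_MInfty ereal_mult_eq_PInfty)

lemma convex_ereal_cmult:
  assumes "convex_ereal \<phi>" "c \<ge> 0" and nt: "\<And>y. \<phi> y \<noteq> -\<infinity>"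
  shows "convex_ereal (\<lambda>y. ereal c * \<phi> y)"
  unfolding convex_ereal_def
proof (intro allI ballI)
  fix x y t assume t: "t \<in> {0..1::real}"
  have "ereal c * \<phi> ((1 - t) *\<^sub>R x + t *\<^sub>R y) \<le> ereal c * (ereal (1 - t) * \<phi> x + ereal t * \<phi> y)"
    using assms t unfolding convex_ereal_def by (auto intro!: ereal_mult_left_mono)
  also have "\<dots> = ereal (1 - t) * (ereal c * \<phi> x) + ereal t * (ereal c * \<phi> y)"
    using t nt by (subst ereal_distrib_left) (auto simp: mult_ac ereal_mult_eq_MInfty)
  finally show "ereal c * \<phi> ((1 - t) *\<^sub>R x + t *\<^sub>R y)
      \<le> ereal (1 - t) * (ereal c * \<phi> x) + ereal t * (ereal c * \<phi> y)" .
qed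

text \<open>Passing to real values on the effective domain makes Jensen's inequality for
  \<open>convex_on\<close> applicable to the averages.\<close>

lemma convex_ereal_imp_convex_on:
  assumes "convex_ereal \<phi>" and nt: "\<And>y. \<phi> y \<noteq> -\<infinity>"
  shows "convex_on {y. \<phi> y \<noteq> \<infinity>} (\<lambda>y. real_of_ereal (\<phi> y))"
proof -
  have key: "\<phi> ((1 - t) *\<^sub>R x + t *\<^sub>R y) \<noteq> \<infinity> \<and>
      real_of_ereal (\<phi> ((1 - t) *\<^sub>R x + t *\<^sub>R y))
        \<le> (1 - t) * real_of_ereal (\<phi> x) + t * real_of_ereal (\<phi> y)"
    if fin: "\<phi> x \<noteq> \<infinity>" "\<phi> y \<noteq> \<infinity>" and t: "t \<in> {0..1}" for x y t
  proof -
    obtain a b where ab: "\<phi> x = ereal a" "\<phi> y = ereal b"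
      using fin nt[of x] nt[of y] by (cases "\<phi> x"; cases "\<phi> y") auto
    have "\<phi> ((1 - t) *\<^sub>R x + t *\<^sub>R y) \<le> ereal (1 - t) * \<phi> x + ereal t * \<phi> y"
      using assms(1) t unfolding convex_ereal_def by blast
    then have "\<phi> ((1 - t) *\<^sub>R x + t *\<^sub>R y) \<le> ereal ((1 - t) * a + t * b)"
      by (simp add: ab)
    then show ?thesis
      using nt[of "(1 - t) *\<^sub>R x + t *\<^sub>R y"] by (simp add: ab, cases "\<phi> ((1 - t) *\<^sub>R x + t *\<^sub>R y)") auto
  qed
  show ?thesis
  proof (rule convex_onI)
    show "convex {y. \<phi> y \<noteq> \<infinity>}"
      unfolding convex_alt using key by auto
  qed (use key in auto)
qed

lemma convex_on_average:
  assumes cvx: "convex_on C F" and "N \<ge> 1" and C: "\<And>i. y (Suc i) \<in> C"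
  shows "average y N \<in> C" "F (average y N) \<le> (\<Sum>i<N. F (y (Suc i))) / real N"
proof -
  \<comment> \<open>The average runs over indices 1 to N, so only \<open>y (Suc i)\<close> enters;
    the starting point may lie outside the domain.\<close>
  have av: "average y N = (\<Sum>i<N. (1 / real N) *\<^sub>R y (Suc i))"
    unfolding average_def scaleR_sum_right
    by (rule sum.reindex_bij_witness[of _ Suc "\<lambda>i. i - 1"]) auto
  have one: "(\<Sum>i<N. 1 / real N) = 1" using \<open>N \<ge> 1\<close> by simp
  have ne: "{..<N} \<noteq> {}" using \<open>N \<ge> 1\<close> by (auto simp: lessThan_empty_iff)
  show "average y N \<in> C"
    unfolding av by (rule convex_sum) (use cvx one C in \<open>auto simp: convex_on_def\<close>)
  have "F (average y N) \<le> (\<Sum>i<N. 1 / real N * F (y (Suc i)))"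
    unfolding av by (rule convex_on_sum) (use cvx one C ne in auto)
  then show "F (average y N) \<le> (\<Sum>i<N. F (y (Suc i))) / real N"
    by (simp add: sum_divide_distrib)
qed

section \<open>The proximal operator\<close>

text \<open>Convexity turns the minimum over a unit ball into a lower bound with linear growth, which
  makes the objective coercive without any separation theorem.\<close>

lemma prox_objective_attains_inf:
  fixes \<phi> :: "'a::euclidean_space \<Rightarrow> ereal"
  assumes "proper \<phi>" "lower_semicontinuous \<phi>" "convex_ereal \<phi>"
  shows "\<exists>p. \<forall>y. \<phi> p + ereal (1 / 2 * (norm (p - z))\<^sup>2) \<le> \<phi> y + ereal (1 / 2 * (norm (y - z))\<^sup>2)"
proof -
  have nt: "\<phi> y \<noteq> -\<infinity>" for y using assms(1) by (simp add: proper_def)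
  obtain a A where A: "\<phi> a = ereal A"
    using assms(1) nt unfolding proper_def by (metis ereal_cases)
  obtain w where w: "\<And>y. y \<in> cball a 1 \<Longrightarrow> \<phi> w \<le> \<phi> y"
    using lower_semicontinuous_attains_inf[OF assms(2), of "cball a 1"] by fastforce
  have "\<phi> w \<le> ereal A" using w[of a] A by simp
  then obtain m where m: "\<phi> w = ereal m" "m \<le> A"
    using nt[of w] by (cases "\<phi> w") auto
  define D where "D = A - m"
  have D: "D \<ge> 0" using m by (simp add: D_def)
  have lower: "ereal (m - norm (y - a) * D) \<le> \<phi> y" for y
  proof (cases "norm (y - a) \<le> 1")
    case True
    then have "ereal m \<le> \<phi> y" using w[of y] m by (simp add: dist_norm norm_minus_commute)
    moreover have "m - norm (y - a) * D \<le> m" using D by simp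
    ultimately show ?thesis by (meson ereal_less_eq(3) order_trans)
  next
    case False
    define r where "r = norm (y - a)"
    have r: "r > 1" using False by (simp add: r_def)
    \<comment> \<open>p is the point of the segment from a to y at distance 1 from a, where the
      bound m is known; convexity carries it out to y.\<close>
    define p where "p = (1 - 1 / r) *\<^sub>R a + (1 / r) *\<^sub>R y"
    have "p - a = (1 / r) *\<^sub>R (y - a)" by (simp add: p_def algebra_simps)
    then have "norm (p - a) = 1" using r by (simp flip: r_def)
    then have "ereal m \<le> \<phi> p" using w[of p] m by (simp add: dist_norm norm_minus_commute)
    also have "\<dots> \<le> ereal (1 - 1 / r) * \<phi> a + ereal (1 / r) * \<phi> y"
      using assms(3) r unfolding convex_ereal_def p_def by auto
    finally have *: "ereal m \<le> ereal (1 - 1 / r) * ereal A + ereal (1 / r) * \<phi> y"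
      by (simp add: A)
    show ?thesis
    proof (cases "\<phi> y")
      case (real b)
      then have "m \<le> (1 - 1 / r) * A + b / r" using * by simp
      then have "m * r \<le> (r - 1) * A + b" using r by (simp add: field_simps)
      then have "m - r * D \<le> b" using m(2) by (simp add: D_def algebra_simps)
      then show ?thesis using real by (simp add: r_def)
    qed (use nt in auto)
  qed
  define k where "k = norm (a - z)"
  \<comment> \<open>For r > R the factor \<open>r - 2 * k - 2 * D\<close> exceeds
    \<open>2 * D + 1\<close> and r exceeds 1. Their product then exceeds \<open>2 * D\<close>, which
    makes the objective outside the ball at least its value at the centre a.\<close>
  define R where "R = 2 * k + 4 * D + 1"
  have k: "k \<ge> 0" by (simp add: k_def)
  have "lower_semicontinuous (\<lambda>y. \<phi> y + ereal (1 / 2 * (norm (y - z))\<^sup>2))"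
    by (intro lower_semicontinuous_add_continuous assms(2) continuous_intros)
  moreover have "cball a R \<noteq> {}" using D k by (simp add: R_def)
  ultimately obtain p where p: "\<And>y. y \<in> cball a R \<Longrightarrow>
      \<phi> p + ereal (1 / 2 * (norm (p - z))\<^sup>2) \<le> \<phi> y + ereal (1 / 2 * (norm (y - z))\<^sup>2)"
    using lower_semicontinuous_attains_inf[of _ "cball a R"] compact_cball by blast
  have "\<phi> p + ereal (1 / 2 * (norm (p - z))\<^sup>2) \<le> \<phi> y + ereal (1 / 2 * (norm (y - z))\<^sup>2)" for y
  proof (cases "y \<in> cball a R")
    case False
    define r where "r = norm (y - a)"
    have r: "r > R" using False by (simp add: r_def dist_norm norm_minus_commute)
    have "\<bar>r - k\<bar> \<le> norm (y - z)"
      using norm_triangle_ineq3[of "y - a" "z - a"] by (simp add: r_def k_def norm_minus_commute)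
    then have sq: "(r - k)\<^sup>2 \<le> (norm (y - z))\<^sup>2" by (simp add: abs_le_square_iff[symmetric])
    have "1 * (2 * D + 1) \<le> r * (r - 2 * k - 2 * D)"
      using r D k by (intro mult_mono) (auto simp: R_def)
    with sq have "A + 1 / 2 * k\<^sup>2 \<le> m - r * D + 1 / 2 * (norm (y - z))\<^sup>2"
      by (simp add: D_def power2_eq_square algebra_simps)
    then have "ereal A + ereal (1 / 2 * k\<^sup>2) \<le> ereal (m - r * D) + ereal (1 / 2 * (norm (y - z))\<^sup>2)"
      by simp
    also have "\<dots> \<le> \<phi> y + ereal (1 / 2 * (norm (y - z))\<^sup>2)"
      unfolding r_def by (intro add_right_mono lower)
    finally have "\<phi> a + ereal (1 / 2 * (norm (a - z))\<^sup>2) \<le> \<phi> y + ereal (1 / 2 * (norm (y - z))\<^sup>2)"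
      by (simp add: A k_def)
    moreover have "a \<in> cball a R" using D k by (simp add: R_def)
    ultimately show ?thesis using p order_trans by blast
  qed (rule p)
  then show ?thesis by blast
qed

text \<open>This is Fermat's rule: \<open>z - p\<close> is a subgradient of \<phi> at the minimiser
  p. It follows by comparing p with nearby points of the segment towards y.\<close>

lemma prox_subgradient:
  fixes \<phi> :: "'a::euclidean_space \<Rightarrow> ereal"
  assumes "proper \<phi>" "lower_semicontinuous \<phi>" "convex_ereal \<phi>"
  shows "\<phi> (prox \<phi> z) \<noteq> \<infinity>"
    and "\<phi> (prox \<phi> z) + ereal ((z - prox \<phi> z) \<bullet> (y - prox \<phi> z)) \<le> \<phi> y"
proof -
  define p where "p = prox \<phi> z"
  have nt: "\<phi> y \<noteq> -\<infinity>" for y using assms(1) by (simp add: proper_def)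
  let ?h = "\<lambda>y. \<phi> y + ereal (1 / 2 * (norm (y - z))\<^sup>2)"
  have "\<exists>p. is_arg_min ?h (\<lambda>_. True) p"
    using prox_objective_attains_inf[OF assms, of z] by (simp add: is_arg_min_linorder)
  then have "is_arg_min ?h (\<lambda>_. True) p"
    unfolding p_def prox_def arg_min_def by (rule someI_ex)
  then have min: "?h p \<le> ?h y" for y by (simp add: is_arg_min_linorder)
  obtain a where a: "\<phi> a \<noteq> \<infinity>" using assms(1) by (auto simp: proper_def)
  have fin: "\<phi> p \<noteq> \<infinity>"
    using min[of a] a nt[of a] by (cases "\<phi> a") auto
  then obtain P where P: "\<phi> p = ereal P" using nt[of p] by (cases "\<phi> p") auto
  show "\<phi> (prox \<phi> z) \<noteq> \<infinity>" using fin by (simp add: p_def)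
  have "\<phi> p + ereal ((z - p) \<bullet> (y - p)) \<le> \<phi> y"
  proof (cases "\<phi> y")
    case (real Y)
    define E where "E = P + (z - p) \<bullet> (y - p) - Y"
    define d where "d = (norm (y - p))\<^sup>2 / 2"
    \<comment> \<open>E is the violation of the subgradient inequality. Minimality against v bounds
      \<open>t * E\<close> by the second-order term \<open>t * (t * d)\<close>; dividing by t and
      letting t tend to 0 gives \<open>E \<le> 0\<close>.\<close>
    have "E \<le> t * d" if t: "0 < t" "t \<le> 1" for t
    proof -
      define v where "v = (1 - t) *\<^sub>R p + t *\<^sub>R y"
      have "\<phi> v \<le> ereal ((1 - t) * P + t * Y)"
        using assms(3) t P real unfolding convex_ereal_def v_def
        by (metis atLeastAtMost_iff less_imp_le plus_ereal.simps(1) times_ereal.simps(1))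
      then have "?h v \<le> ereal ((1 - t) * P + t * Y) + ereal (1 / 2 * (norm (v - z))\<^sup>2)"
        by (rule add_right_mono)
      with min[of v] have
        "ereal P + ereal (1 / 2 * (norm (p - z))\<^sup>2) \<le> ereal ((1 - t) * P + t * Y) + ereal (1 / 2 * (norm (v - z))\<^sup>2)"
        unfolding P by (rule order_trans)
      then have "P + 1 / 2 * (norm (p - z))\<^sup>2 \<le> (1 - t) * P + t * Y + 1 / 2 * (norm (v - z))\<^sup>2"
        by simp
      moreover have "v - z = (p - z) + t *\<^sub>R (y - p)" by (simp add: v_def algebra_simps)
      then have "(norm (v - z))\<^sup>2 = (norm (p - z))\<^sup>2 - 2 * t * ((z - p) \<bullet> (y - p)) + t\<^sup>2 * (norm (y - p))\<^sup>2"
        by (simp only: power2_norm_eq_inner)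
          (simp add: inner_simps power2_eq_square algebra_simps inner_commute)
      ultimately have "t * E \<le> t * (t * d)"
        by (simp add: E_def d_def power2_eq_square algebra_simps)
      then show ?thesis using t by simp
    qed
    then have "\<forall>\<^sub>F t in at_right 0. E \<le> t * d"
      by (auto simp: eventually_at_right_field intro!: exI[of _ 1])
    moreover have "((\<lambda>t. t * d) \<longlongrightarrow> 0 * d) (at_right 0)" by (intro tendsto_intros)
    ultimately have "E \<le> 0 * d"
      by (intro tendsto_lowerbound) auto
    then show ?thesis using P real by (simp add: E_def)
  qed (use nt in auto)
  then show "\<phi> (prox \<phi> z) + ereal ((z - prox \<phi> z) \<bullet> (y - prox \<phi> z)) \<le> \<phi> y"
    by (simp add: p_def)
qed

lemma prox_scaled_subgradient:
  fixes \<phi> :: "'a::euclidean_space \<Rightarrow> ereal"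
  assumes "proper \<phi>" "lower_semicontinuous \<phi>" "convex_ereal \<phi>" "c > 0"
    and p: "p = prox (\<lambda>y. ereal c * \<phi> y) z"
  shows "\<phi> p \<noteq> \<infinity>"
    and "\<phi> y \<noteq> \<infinity> \<Longrightarrow>
      real_of_ereal (\<phi> p) - real_of_ereal (\<phi> y) \<le> (z - p) \<bullet> (p - y) / c"
proof -
  have nt: "\<phi> y \<noteq> -\<infinity>" for y using assms(1) by (simp add: proper_def)
  have cls: "proper (\<lambda>y. ereal c * \<phi> y)" "lower_semicontinuous (\<lambda>y. ereal c * \<phi> y)"
    "convex_ereal (\<lambda>y. ereal c * \<phi> y)"
    using assms(4) by (auto intro: proper_cmult[OF assms(1)] lower_semicontinuous_cmult[OF assms(2)]
        convex_ereal_cmult[OF assms(3) _ nt])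
  show fin: "\<phi> p \<noteq> \<infinity>"
    using prox_subgradient(1)[OF cls, of z] \<open>c > 0\<close> unfolding p by auto
  assume "\<phi> y \<noteq> \<infinity>"
  then obtain P Y where PY: "\<phi> p = ereal P" "\<phi> y = ereal Y"
    using fin nt by (metis ereal_cases)
  have "c * P + (z - p) \<bullet> (y - p) \<le> c * Y"
    using prox_subgradient(2)[OF cls, of z y] unfolding p[symmetric] PY by simp
  then show "real_of_ereal (\<phi> p) - real_of_ereal (\<phi> y) \<le> (z - p) \<bullet> (p - y) / c"
    using \<open>c > 0\<close> by (simp add: PY field_simps inner_diff_right)
qed

section \<open>The convex conjugate\<close>

lemma proper_conjugate:
  fixes g :: "'a::euclidean_space \<Rightarrow> ereal"
  assumes "proper g" "lower_semicontinuous g" "convex_ereal g"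
  shows "proper (conjugate g)"
  unfolding proper_def
proof (intro conjI allI)
  have nt: "g y \<noteq> -\<infinity>" for y using assms(1) by (simp add: proper_def)
  fix u
  obtain a A where A: "g a = ereal A"
    using assms(1) nt unfolding proper_def by (metis ereal_cases)
  have "ereal (u \<bullet> a - A) \<le> conjugate g u"
    unfolding conjugate_def by (rule SUP_upper2[of a]) (simp_all add: A)
  then show "conjugate g u \<noteq> -\<infinity>" by auto
next
  have nt: "g y \<noteq> -\<infinity>" for y using assms(1) by (simp add: proper_def)
  \<comment> \<open>A conjugate is finite at every subgradient. The prox point of 0 has the
    subgradient \<open>- p\<close>, and the resulting affine minorant of g bounds the supremum at
    \<open>- p\<close>.\<close>
  define p where "p = prox g 0"
  note p = prox_subgradient[OF assms, of 0, folded p_def]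
  obtain P where P: "g p = ereal P" using p(1) nt[of p] by (cases "g p") auto
  have "conjugate g (- p) \<le> ereal ((- p) \<bullet> p - P)"
    unfolding conjugate_def
  proof (rule SUP_least)
    fix y
    show "ereal (- p \<bullet> y) - g y \<le> ereal ((- p) \<bullet> p - P)"
      using p(2)[of y] P nt[of y] by (cases "g y") (auto simp: inner_diff_right)
  qed
  then show "\<exists>u. conjugate g u \<noteq> \<infinity>" by (intro exI[of _ "- p"]) auto
qed

text \<open>The conjugate is a supremum of continuous affine functions of u; points x with
  \<open>g x = \<infinity>\<close> contribute only empty superlevel sets.\<close>

lemma lower_semicontinuous_conjugate:
  assumes "\<And>y. g y \<noteq> -\<infinity>"
  shows "lower_semicontinuous (conjugate g)"
  unfolding lower_semicontinuous_iff_open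
proof
  fix c
  have "{u. c < conjugate g u} = (\<Union>x. {u. c < ereal (u \<bullet> x) - g x})"
    by (auto simp: conjugate_def less_SUP_iff)
  also have "open \<dots>"
  proof (intro open_UN ballI)
    fix x
    show "open {u. c < ereal (u \<bullet> x) - g x}"
    proof (cases "g x")
      case (real r)
      have "open {u. c < ereal (u \<bullet> x - r)}"
        by (intro open_Collect_less continuous_intros)
      then show ?thesis using real by simp
    qed (use assms in auto)
  qed
  finally show "open {u. c < conjugate g u}" .
qed

lemma convex_ereal_conjugate:
  assumes "\<And>y. g y \<noteq> -\<infinity>"
  shows "convex_ereal (conjugate g)"
  unfolding convex_ereal_def
proof (intro allI ballI)
  fix v w t assume t: "t \<in> {0..1::real}"
  show "conjugate g ((1 - t) *\<^sub>R v + t *\<^sub>R w)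
      \<le> ereal (1 - t) * conjugate g v + ereal t * conjugate g w"
    unfolding conjugate_def[of _ "_ + _"]
  proof (rule SUP_least)
    fix x
    show "ereal (((1 - t) *\<^sub>R v + t *\<^sub>R w) \<bullet> x) - g x
        \<le> ereal (1 - t) * conjugate g v + ereal t * conjugate g w"
    proof (cases "g x")
      case (real r)
      have up: "ereal (s \<bullet> x - r) \<le> conjugate g s" for s
        unfolding conjugate_def by (rule SUP_upper2[of x]) (simp_all add: real)
      have "ereal (((1 - t) *\<^sub>R v + t *\<^sub>R w) \<bullet> x) - g x
          = ereal (1 - t) * ereal (v \<bullet> x - r) + ereal t * ereal (w \<bullet> x - r)"
        by (simp add: real inner_simps algebra_simps)
      also have "\<dots> \<le> ereal (1 - t) * conjugate g v + ereal t * conjugate g w"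
        using t by (intro add_mono ereal_mult_left_mono up) auto
      finally show ?thesis .
    qed (use assms in auto)
  qed
qed

section \<open>Telescoping in a semi-inner product\<close>

text \<open>Positivity is only semidefinite because \<open>cp_form\<close> can degenerate at the
  boundary step size \<open>\<tau> * \<sigma> = 1 / L\<^sup>2\<close>.\<close>

locale semi_inner_form =
  fixes B :: "'a::real_vector \<Rightarrow> 'a \<Rightarrow> real"
  assumes bilinear: "bilinear B" and sym: "B a b = B b a" and nonneg: "0 \<le> B a a"
begin

lemma double_le: "2 * B a b \<le> B a a + B b b"
  using nonneg[of "a - b"] sym[of a b]
  by (simp add: bilinear_lsub[OF bilinear] bilinear_rsub[OF bilinear])

text \<open>Cauchy-Schwarz against the constant sequence 1, obtained by summing
  \<open>double_le\<close> over all pairs of indices.\<close>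

lemma sum_sum_le:
  assumes "finite I"
  shows "B (sum d I) (sum d I) \<le> card I * (\<Sum>i\<in>I. B (d i) (d i))"
proof -
  have "2 * B (sum d I) (sum d I) = (\<Sum>i\<in>I. \<Sum>j\<in>I. 2 * B (d i) (d j))"
    by (simp add: bilinear_sum[OF bilinear] sum.cartesian_product sum_distrib_left split_def)
  also have "\<dots> \<le> (\<Sum>i\<in>I. \<Sum>j\<in>I. B (d i) (d i) + B (d j) (d j))"
    by (intro sum_mono double_le)
  also have "\<dots> = 2 * (card I * (\<Sum>i\<in>I. B (d i) (d i)))"
    by (simp add: sum.distrib sum_distrib_left)
  finally show ?thesis by simp
qed

text \<open>The path from \<open>z 0\<close> through \<open>z N\<close> to \<open>w\<close> consists of \<open>N + 1\<close> steps, whose squared lengths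
  are exactly the terms usually discarded after telescoping; Cauchy-Schwarz gains the factor \<open>N / (N + 1)\<close>.\<close>

lemma proximal_point_sum_le:
  "(\<Sum>i<N. B (z i - z (Suc i)) (z (Suc i) - w))
    \<le> real N / (2 * (real N + 1)) * B (z 0 - w) (z 0 - w)"
proof -
  \<comment> \<open>Index N + 1 stands for w, so \<open>d N\<close> is \<open>z N - w\<close>, while
    S collects only the N steps of the iteration.\<close>
  define y where "y i = (if i \<le> N then z i else w)" for i
  define d where "d i = y i - y (Suc i)" for i
  define S where "S = (\<Sum>i<N. B (d i) (d i))"
  define q where "q v = B v v" for v
  have dz: "d i = z i - z (Suc i)" if "i < N" for i using that by (simp add: d_def y_def)
  have "z 0 - w = sum d {..<Suc N}"
    unfolding d_def by (subst sum_lessThan_telescope') (simp add: y_def)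
  then have "q (z 0 - w) \<le> card {..<Suc N} * (\<Sum>i<Suc N. B (d i) (d i))"
    unfolding q_def by (metis sum_sum_le finite_lessThan)
  then have path: "q (z 0 - w) \<le> (real N + 1) * (S + q (z N - w))"
    by (simp add: S_def q_def d_def y_def algebra_simps)
  \<comment> \<open>The three-point (polarisation) identity; its first two terms telescope.\<close>
  have "2 * B (a - b) (b - w) = q (a - w) - q (b - w) - B (a - b) (a - b)" for a b
    using sym[of a b] sym[of a w] sym[of b w] unfolding q_def
    by (simp add: bilinear_lsub[OF bilinear] bilinear_rsub[OF bilinear])
  then have "2 * (\<Sum>i<N. B (z i - z (Suc i)) (z (Suc i) - w))
      = (\<Sum>i<N. (q (z i - w) - q (z (Suc i) - w)) - B (d i) (d i))"
    unfolding sum_distrib_left by (intro sum.cong) (auto simp: dz)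
  also have "\<dots> = q (z 0 - w) - q (z N - w) - S"
    unfolding S_def by (subst sum_subtractf, subst sum_lessThan_telescope') (rule refl)
  \<comment> \<open>By \<open>path\<close>, the subtracted quantity \<open>q (z N - w) + S\<close>
    is at least the share 1 / (N + 1) of \<open>q (z 0 - w)\<close>.\<close>
  also have "\<dots> \<le> q (z 0 - w) - q (z 0 - w) / (real N + 1)"
    using path by (simp add: field_simps)
  also have "\<dots> = real N / (real N + 1) * q (z 0 - w)" by (simp add: field_simps)
  finally show ?thesis by (simp add: q_def field_simps)
qed

end

section \<open>The Chambolle-Pock form\<close>

text \<open>The preconditioner of the method: its off-diagonal blocks absorb the extrapolation
  \<open>2 *\<^sub>R xs (Suc i) - xs i\<close>, so that both updates form one implicit step.\<close>

definition cp_form ::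
  "real^'n^'m \<Rightarrow> real \<Rightarrow> real \<Rightarrow> (real^'n) \<times> (real^'m) \<Rightarrow> (real^'n) \<times> (real^'m) \<Rightarrow> real" where
  "cp_form M \<tau> \<sigma> z w = (fst z \<bullet> fst w) / \<tau> + (snd z \<bullet> snd w) / \<sigma>
     - snd z \<bullet> (M *v fst w) - snd w \<bullet> (M *v fst z)"

lemma semi_inner_form_cp_form:
  fixes M :: "real^'n^'m"
  assumes "onorm ((*v) M) \<le> L" "L > 0" "\<tau> > 0" "\<sigma> > 0" "\<tau> * \<sigma> \<le> 1 / L\<^sup>2"
  shows "semi_inner_form (cp_form M \<tau> \<sigma>)"
proof
  show "bilinear (cp_form M \<tau> \<sigma>)"
    unfolding bilinear_def
    by (auto intro!: linearI simp: cp_form_def inner_simps matrix_vector_right_distrib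
        matrix_vector_mult_scaleR add_divide_distrib algebra_simps)
  show "cp_form M \<tau> \<sigma> a b = cp_form M \<tau> \<sigma> b a" for a b
    by (simp add: cp_form_def inner_commute)
  show "0 \<le> cp_form M \<tau> \<sigma> z z" for z
  proof -
    obtain x u where z: "z = (x, u)" by fastforce
    let ?a = "norm x" and ?b = "norm u"
    have "norm (M *v x) \<le> onorm ((*v) M) * ?a"
      by (rule onorm) simp
    also have "\<dots> \<le> L * ?a" using assms(1) by (simp add: mult_right_mono)
    finally have "u \<bullet> (M *v x) \<le> ?b * (L * ?a)"
      by (meson norm_cauchy_schwarz mult_left_mono norm_ge_zero order_trans)
    \<comment> \<open>Completing the square in \<open>norm x\<close> leaves
      \<open>(1 / \<sigma> - \<tau> * L\<^sup>2) * ?b\<^sup>2\<close>, which the step-size condition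
      makes nonnegative.\<close>
    moreover have "?a\<^sup>2 / \<tau> - 2 * (?b * (L * ?a)) + \<tau> * L\<^sup>2 * ?b\<^sup>2 = (?a - \<tau> * L * ?b)\<^sup>2 / \<tau>"
      using \<open>\<tau> > 0\<close> by (simp add: field_simps power2_eq_square)
    then have "0 \<le> ?a\<^sup>2 / \<tau> - 2 * (?b * (L * ?a)) + \<tau> * L\<^sup>2 * ?b\<^sup>2"
      using \<open>\<tau> > 0\<close> by simp
    moreover have "\<tau> * L\<^sup>2 \<le> 1 / \<sigma>" using assms by (simp add: field_simps)
    then have "\<tau> * L\<^sup>2 * ?b\<^sup>2 \<le> 1 / \<sigma> * ?b\<^sup>2" by (rule mult_right_mono) simp
    ultimately show ?thesis
      by (simp add: z cp_form_def power2_norm_eq_inner)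
  qed
qed

section \<open>The primal-dual gap at the averaged iterates\<close>

theorem theorem4p8:
  fixes f :: "real^'n \<Rightarrow> ereal" and g :: "real^'m \<Rightarrow> ereal"
    and M :: "real^'n^'m" and L\<^sub>M \<tau> \<sigma> :: real
    and xs :: "nat \<Rightarrow> real^'n" and us :: "nat \<Rightarrow> real^'m"
    and N :: nat and x :: "real^'n" and u :: "real^'m"
  assumes "proper f" "lower_semicontinuous f" "convex_ereal f"
    and "proper g" "lower_semicontinuous g" "convex_ereal g"
    and "onorm ((*v) M) \<le> L\<^sub>M" "L\<^sub>M > 0"
    and "\<tau> > 0" "\<sigma> > 0" "\<tau> * \<sigma> \<le> 1 / L\<^sub>M\<^sup>2"
    and "\<And>i. xs (Suc i) = prox (\<lambda>y. ereal \<tau> * f y) (xs i - \<tau> *\<^sub>R (transpose M *v us i))"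
    and "\<And>i. us (Suc i) =
          prox (\<lambda>v. ereal \<sigma> * conjugate g v) (us i + \<sigma> *\<^sub>R (M *v (2 *\<^sub>R xs (Suc i) - xs i)))"
    and "N \<ge> 1"
  shows "lagrangian M f g (average xs N) u - lagrangian M f g x (average us N)
    \<le> ereal (1 / (2 * (real N + 1)) *
        ((norm (x - xs 0))\<^sup>2 / \<tau> + (norm (u - us 0))\<^sup>2 / \<sigma> - 2 * ((u - us 0) \<bullet> (M *v (x - xs 0)))))"
proof -
  define G where "G = conjugate g"
  have ntf: "f y \<noteq> -\<infinity>" for y using assms(1) by (simp add: proper_def)
  have ntg: "g y \<noteq> -\<infinity>" for y using assms(4) by (simp add: proper_def)
  have G: "proper G" "lower_semicontinuous G" "convex_ereal G"
    unfolding G_def by (intro proper_conjugate lower_semicontinuous_conjugate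
        convex_ereal_conjugate assms(4-6) ntg)+
  have ntG: "G v \<noteq> -\<infinity>" for v using G(1) by (simp add: proper_def)
  let ?F = "\<lambda>y. real_of_ereal (f y)" and ?H = "\<lambda>v. real_of_ereal (G v)"
  let ?X = "average xs N" and ?U = "average us N"
  note subF = prox_scaled_subgradient[OF assms(1-3) \<open>\<tau> > 0\<close> assms(12)]
  note subG = prox_scaled_subgradient[OF G \<open>\<sigma> > 0\<close> assms(13)[folded G_def]]
  note avF = convex_on_average[OF convex_ereal_imp_convex_on[OF assms(3) ntf] \<open>N \<ge> 1\<close>, of xs]
  note avG = convex_on_average[OF convex_ereal_imp_convex_on[OF G(3) ntG] \<open>N \<ge> 1\<close>, of us]
  obtain FX where FX: "f ?X = ereal FX"
    using avF(1) subF(1) ntf[of ?X] by (cases "f ?X") auto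
  obtain HU where HU: "G ?U = ereal HU"
    using avG(1) subG(1) ntG[of ?U] by (cases "G ?U") auto
  show ?thesis
  proof (cases "f x = \<infinity> \<or> G u = \<infinity>")
    \<comment> \<open>Finiteness of f and G at the averages excludes an indeterminate difference, so
      the left-hand side is \<open>-\<infinity>\<close>.\<close>
    case True
    then show ?thesis
      using FX HU ntf[of x] ntG[of u] unfolding lagrangian_def G_def[symmetric]
      by (cases "f x"; cases "G u") auto
  next
    case False
    then obtain Fx Hu where fin: "f x = ereal Fx" "G u = ereal Hu"
      using ntf[of x] ntG[of u] by (cases "f x"; cases "G u") auto
    interpret semi_inner_form "cp_form M \<tau> \<sigma>"
      by (rule semi_inner_form_cp_form[OF assms(7-11)])
    define z where "z i = (xs i, us i)" for i
    define w where "w = (x, u)"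
    \<comment> \<open>The real-valued Lagrangian gap of the iterate \<open>z (Suc i)\<close> against
      w.\<close>
    define gap where "gap i = u \<bullet> (M *v xs (Suc i)) - us (Suc i) \<bullet> (M *v x)
      + (?F (xs (Suc i)) - Fx) + (?H (us (Suc i)) - Hu)" for i
    have step: "gap i \<le> cp_form M \<tau> \<sigma> (z i - z (Suc i)) (z (Suc i) - w)" for i
    proof -
      let ?a = "xs i" and ?b = "us i" and ?p = "xs (Suc i)" and ?q = "us (Suc i)"
      have "?F ?p - Fx \<le> (?a - \<tau> *\<^sub>R (transpose M *v ?b) - ?p) \<bullet> (?p - x) / \<tau>"
        using subF(2)[of x i] fin by simp
      also have "\<dots> = (?a - ?p) \<bullet> (?p - x) / \<tau> - ?b \<bullet> (M *v (?p - x))"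
        using \<open>\<tau> > 0\<close> by (simp add: transpose_matrix_vector dot_lmul_matrix inner_diff_left
            diff_divide_distrib)
      finally have F: "?F ?p - Fx \<le> \<dots>" .
      have "?H ?q - Hu \<le> (?b + \<sigma> *\<^sub>R (M *v (2 *\<^sub>R ?p - ?a)) - ?q) \<bullet> (?q - u) / \<sigma>"
        using subG(2)[of u i] fin by simp
      also have "\<dots> = (?b - ?q) \<bullet> (?q - u) / \<sigma> + (?q - u) \<bullet> (M *v (2 *\<^sub>R ?p - ?a))"
        using \<open>\<sigma> > 0\<close> by (simp add: inner_simps field_simps inner_commute)
      finally have H: "?H ?q - Hu \<le> \<dots>" .
      \<comment> \<open>Split \<open>2 *\<^sub>R ?p - ?a\<close> as ?p plus \<open>?p - ?a\<close>.
        The first part turns the Lagrangian coupling into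
        \<open>?q \<bullet> (M *v (?p - x))\<close>, which joins the ?b term; the second is the
        other off-diagonal term of \<open>cp_form\<close>.\<close>
      have "u \<bullet> (M *v ?p) - ?q \<bullet> (M *v x) - ?b \<bullet> (M *v (?p - x))
          + (?q - u) \<bullet> (M *v (2 *\<^sub>R ?p - ?a))
          = - ((?b - ?q) \<bullet> (M *v (?p - x))) - (?q - u) \<bullet> (M *v (?a - ?p))"
        by (simp add: matrix_vector_mult_diff_distrib matrix_vector_mult_scaleR inner_simps)
      with F H show ?thesis
        by (simp add: gap_def z_def w_def cp_form_def)
    qed
    \<comment> \<open>The coupling terms are linear in the averaged variable and pass to the
      averages exactly; f and G pass by Jensen's inequality.\<close>
    have "real N * ((u \<bullet> (M *v ?X) + FX - Hu) - (?U \<bullet> (M *v x) + Fx - HU)) \<le> (\<Sum>i<N. gap i)"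
    proof -
      have N: "real N > 0" using \<open>N \<ge> 1\<close> by simp
      have av: "real N *\<^sub>R average y N = (\<Sum>i<N. y (Suc i))" for y :: "nat \<Rightarrow> 'c::real_vector"
        using N by (simp add: average_def sum.atLeast1_atMost_eq)
      have "real N * (u \<bullet> (M *v ?X)) = u \<bullet> (M *v (real N *\<^sub>R ?X))"
        by (simp add: matrix_vector_mult_scaleR)
      then have "real N * (u \<bullet> (M *v ?X)) = (\<Sum>i<N. u \<bullet> (M *v xs (Suc i)))"
        unfolding av by (simp add: linear_sum[OF matrix_vector_mul_linear] inner_sum_right)
      moreover have "real N * (?U \<bullet> (M *v x)) = (real N *\<^sub>R ?U) \<bullet> (M *v x)"
        by simp
      then have "real N * (?U \<bullet> (M *v x)) = (\<Sum>i<N. us (Suc i) \<bullet> (M *v x))"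
        unfolding av by (simp add: inner_sum_left)
      moreover have "real N * FX \<le> (\<Sum>i<N. ?F (xs (Suc i)))"
        using avF(2) subF(1) FX N by (simp add: field_simps)
      moreover have "real N * HU \<le> (\<Sum>i<N. ?H (us (Suc i)))"
        using avG(2) subG(1) HU N by (simp add: field_simps)
      ultimately show ?thesis
        by (simp add: gap_def sum.distrib sum_subtractf algebra_simps)
    qed
    also have "\<dots> \<le> (\<Sum>i<N. cp_form M \<tau> \<sigma> (z i - z (Suc i)) (z (Suc i) - w))"
      by (intro sum_mono step)
    also have "\<dots> \<le> real N / (2 * (real N + 1)) * cp_form M \<tau> \<sigma> (z 0 - w) (z 0 - w)"
      by (rule proximal_point_sum_le)
    also have "cp_form M \<tau> \<sigma> (z 0 - w) (z 0 - w) = (norm (x - xs 0))\<^sup>2 / \<tau>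
        + (norm (u - us 0))\<^sup>2 / \<sigma> - 2 * ((u - us 0) \<bullet> (M *v (x - xs 0)))"
      by (simp add: cp_form_def z_def w_def power2_norm_eq_inner inner_simps
          matrix_vector_mult_diff_distrib inner_commute add.commute)
    finally have "real N * ((u \<bullet> (M *v ?X) + FX - Hu) - (?U \<bullet> (M *v x) + Fx - HU))
        \<le> real N * (1 / (2 * (real N + 1)) * ((norm (x - xs 0))\<^sup>2 / \<tau>
          + (norm (u - us 0))\<^sup>2 / \<sigma> - 2 * ((u - us 0) \<bullet> (M *v (x - xs 0)))))"
      by simp
    then have "(u \<bullet> (M *v ?X) + FX - Hu) - (?U \<bullet> (M *v x) + Fx - HU)
        \<le> 1 / (2 * (real N + 1)) * ((norm (x - xs 0))\<^sup>2 / \<tau>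
          + (norm (u - us 0))\<^sup>2 / \<sigma> - 2 * ((u - us 0) \<bullet> (M *v (x - xs 0))))"
      by (rule mult_left_le_imp_le) (use \<open>N \<ge> 1\<close> in simp)
    then show ?thesis
      by (simp add: FX HU fin lagrangian_def flip: G_def)
  qed
qed

end
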